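(* (Lebourg mean-value theorem) Let $C$ be a convex subset of a real vector space that is symmetric with respect to a point $x_0\in C$, let $\mu$ be the Minkowski functional of $C-x_0$, and let $\varphi:C\to\mathbb{R}$ be a $\mu$-Lipschitz function with constant $L>0$. If $x,y\in B_\mu(x_0,1)$ are distinct points, then there exists a point $z$ in the open line segment between $x$ and $y$ such that $$\varphi(y)-\varphi(x)\in\{\langle\zeta,y-x\rangle:\zeta\in\partial^\mu_C\varphi(z)\}.$$
   Context: $C$ is symmetric with respect to $x_0$ if $C-x_0=-(C-x_0)$. Put $X_0:=\operatorname{span}(C-x_0)$, with algebraic dual $X_0'$, and $\langle\zeta,v\rangle=\zeta(v)$. The Minkowski functional of $C-x_0$ is $\mu(v)=\inf\{t>0:v\in t(C-x_0)\}$ (a finite seminorm on $X_0$). $B_\mu(x_0,1):=\{x\in x_0+X_0:\mu(x-x_0)<1\}\subset C$. $\varphi$ is $\mu$-Lipschitz with constant $L$ if $|\varphi(x)-\varphi(y)|\le L\mu(x-y)$ for all $x,y\in C$. For $x\in B_\mu(x_0,1)$, $v\in X_0$, $$\varphi^\circ(x,v):=\limsup_{\mu(y-x)\to0,\ t\to0+}\frac{\varphi(y+tv)-\varphi(y)}{t},$$ $$\partial^\mu_C\varphi(x):=\{\zeta\in X_0':\varphi^\circ(x,v)\ge\langle\zeta,v\rangle\text{ for all }v\in X_0\}.$$ *)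

theory Defs
  imports "HOL-Analysis.Analysis"
begin

definition translated :: "'a::real_vector set \<Rightarrow> 'a \<Rightarrow> 'a set" where
  "translated C x0 = (\<lambda>c. c - x0) ` C"

definition symmetric_wrt :: "'a::real_vector set \<Rightarrow> 'a \<Rightarrow> bool" where
  "symmetric_wrt C x0 \<longleftrightarrow> translated C x0 = uminus ` translated C x0"

definition dir_space :: "'a::real_vector set \<Rightarrow> 'a \<Rightarrow> 'a set" where
  "dir_space C x0 = span (translated C x0)"

text \<open>Linear functionals defined on the subspace \<open>X\<close> only; \<^const>\<open>extensional\<close> fixes the
  irrelevant values outside \<open>X\<close>, so that equal functionals are equal as HOL functions.\<close>

definition algebraic_dual :: "'a::real_vector set \<Rightarrow> ('a \<Rightarrow> real) set" where
  "algebraic_dual X = {\<zeta> \<in> extensional X.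
     (\<forall>u\<in>X. \<forall>v\<in>X. \<zeta> (u + v) = \<zeta> u + \<zeta> v) \<and> (\<forall>c. \<forall>v\<in>X. \<zeta> (c *\<^sub>R v) = c * \<zeta> v)}"

text \<open>The Minkowski functional of \<open>C - x0\<close>. It is only meaningful on \<^term>\<open>dir_space C x0\<close>:
  for other \<open>v\<close> the infimum is taken over the empty set of reals.\<close>

definition minkowski :: "'a::real_vector set \<Rightarrow> 'a \<Rightarrow> 'a \<Rightarrow> real" where
  "minkowski C x0 v = Inf {t. 0 < t \<and> v \<in> (\<lambda>w. t *\<^sub>R w) ` translated C x0}"

definition minkowski_unit_ball :: "'a::real_vector set \<Rightarrow> 'a \<Rightarrow> 'a set" where
  "minkowski_unit_ball C x0 =
     {x \<in> (\<lambda>w. x0 + w) ` dir_space C x0. minkowski C x0 (x - x0) < 1}"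

text \<open>A function \<open>C \<rightarrow> \<real>\<close> is represented by a total function whose values outside \<open>C\<close> are irrelevant.\<close>

definition minkowski_lipschitz ::
    "real \<Rightarrow> 'a::real_vector set \<Rightarrow> 'a \<Rightarrow> ('a \<Rightarrow> real) \<Rightarrow> bool" where
  "minkowski_lipschitz L C x0 \<phi> \<longleftrightarrow>
     (\<forall>x\<in>C. \<forall>y\<in>C. \<bar>\<phi> x - \<phi> y\<bar> \<le> L * minkowski C x0 (x - y))"

text \<open>The filter \<open>\<mu>(y - x) \<rightarrow> 0\<close>, with \<open>y\<close> ranging over the domain \<open>C\<close> of \<open>\<phi>\<close>; the value
  \<open>y = x\<close> is not excluded. If \<open>x\<close> lies in the open unit ball, then every \<open>y \<in> x0 + X0\<close> with
  \<open>\<mu>(y - x)\<close> small belongs to \<open>C\<close>, so the restriction to \<open>C\<close> is the same as the one to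
  \<open>x0 + X0\<close>. Likewise \<open>y + t v \<in> C\<close> holds eventually for \<open>v \<in> X0\<close> in the limit superior below.\<close>

definition minkowski_nhds :: "'a::real_vector set \<Rightarrow> 'a \<Rightarrow> 'a \<Rightarrow> 'a filter" where
  "minkowski_nhds C x0 x =
     inf (filtercomap (\<lambda>y. minkowski C x0 (y - x)) (nhds 0)) (principal C)"

definition clarke_derivative ::
    "'a::real_vector set \<Rightarrow> 'a \<Rightarrow> ('a \<Rightarrow> real) \<Rightarrow> 'a \<Rightarrow> 'a \<Rightarrow> ereal" where
  "clarke_derivative C x0 \<phi> x v =
     Limsup (minkowski_nhds C x0 x \<times>\<^sub>F at_right (0::real))
       (\<lambda>(y, t). ereal ((\<phi> (y + t *\<^sub>R v) - \<phi> y) / t))"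

definition clarke_subdifferential ::
    "'a::real_vector set \<Rightarrow> 'a \<Rightarrow> ('a \<Rightarrow> real) \<Rightarrow> 'a \<Rightarrow> ('a \<Rightarrow> real) set" where
  "clarke_subdifferential C x0 \<phi> x =
     {\<zeta> \<in> algebraic_dual (dir_space C x0).
        \<forall>v \<in> dir_space C x0. clarke_derivative C x0 \<phi> x v \<ge> ereal (\<zeta> v)}"

end

theory Submission
  imports Defs
begin

text \<open>Along the segment the function \<open>t \<mapsto> \<phi> (x + t d) - t (\<phi> y - \<phi> x)\<close>, with \<open>d = y - x\<close>, takes equal
  values at the endpoints, so it has an extremum at an interior point \<open>z\<close>. Difference quotients
  based at \<open>z\<close> (for a minimum) or ending at \<open>z\<close> (for a maximum) show that the Clarke derivative
  at \<open>z\<close> is at least \<open>\<phi> y - \<phi> x\<close> in the direction \<open>d\<close> and at least \<open>\<phi> x - \<phi> y\<close> in the direction \<open>- d\<close>. The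
  Clarke derivative is sublinear, so the Hahn--Banach theorem yields a linear functional below it
  with value \<open>\<phi> y - \<phi> x\<close> at \<open>d\<close>. Hahn--Banach itself follows from Zorn's lemma, because minimal
  sublinear functionals are linear.\<close>

section \<open>Sublinear functionals\<close>

text \<open>Homogeneity for \<open>k > 0\<close> already fixes the value at the origin, since
  \<open>p 0 = 2 * p 0\<close>.\<close>

definition sublinear :: "('a::real_vector \<Rightarrow> real) \<Rightarrow> bool" where
  "sublinear p \<longleftrightarrow> (\<forall>u v. p (u + v) \<le> p u + p v) \<and> (\<forall>k>0. \<forall>v. p (k *\<^sub>R v) = k * p v)"

lemma sublinear_add: "sublinear p \<Longrightarrow> p (u + v) \<le> p u + p v"
  by (simp add: sublinear_def)

lemma sublinear_scale_pos: "sublinear p \<Longrightarrow> 0 < k \<Longrightarrow> p (k *\<^sub>R v) = k * p v"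
  by (simp add: sublinear_def)

lemma sublinear_zero:
  assumes "sublinear p" shows "p 0 = 0"
  using sublinear_scale_pos[OF assms, of 2 0] by simp

lemma sublinear_scale: "sublinear p \<Longrightarrow> 0 \<le> k \<Longrightarrow> p (k *\<^sub>R v) = k * p v"
  by (cases "k = 0") (auto simp: sublinear_zero sublinear_scale_pos)

lemma sublinear_minus:
  assumes "sublinear p" shows "- p (- v) \<le> p v"
  using sublinear_add[OF assms, of v "- v"] sublinear_zero[OF assms] by simp

text \<open>The largest sublinear functional below \<open>p\<close> whose value at \<open>- d\<close> is at most \<open>- c\<close>.\<close>

definition lowered :: "('a::real_vector \<Rightarrow> real) \<Rightarrow> 'a \<Rightarrow> real \<Rightarrow> 'a \<Rightarrow> real" where
  "lowered p d c v = (INF s\<in>{0..}. p (v + s *\<^sub>R d) - s * c)"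

lemma lowered_ge:
  assumes "\<And>s. 0 \<le> s \<Longrightarrow> b \<le> p (v + s *\<^sub>R d) - s * c"
  shows "b \<le> lowered p d c v"
  unfolding lowered_def by (rule cINF_greatest) (use assms in auto)

text \<open>The infimum has to be bounded below, and here \<open>c \<le> p d\<close> enters: it
  gives \<open>s * c \<le> p (s *\<^sub>R d)\<close>, and subadditivity at
  \<open>v + s *\<^sub>R d\<close> and \<open>- v\<close> turns this into the bound
  \<open>- p (- v)\<close>, uniform in \<open>s\<close>.\<close>

lemma lowered_le:
  assumes p: "sublinear p" and c: "c \<le> p d" and "0 \<le> s"
  shows "lowered p d c v \<le> p (v + s *\<^sub>R d) - s * c"
  unfolding lowered_def
proof (rule cINF_lower)
  have "- p (- v) \<le> p (v + s *\<^sub>R d) - s * c" if "0 \<le> s" for s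
  proof -
    have "s * c \<le> p (s *\<^sub>R d)"
      using sublinear_scale[OF p that, of d] c that by (simp add: mult_left_mono)
    then show ?thesis using sublinear_add[OF p, of "v + s *\<^sub>R d" "- v"] by simp
  qed
  then show "bdd_below ((\<lambda>s. p (v + s *\<^sub>R d) - s * c) ` {0..})"
    by (auto intro!: bdd_belowI2[where m = "- p (- v)"])
qed (use assms in simp)

lemma lowered_le_self:
  assumes "sublinear p" "c \<le> p d" shows "lowered p d c v \<le> p v"
  using lowered_le[OF assms, of 0 v] by simp

lemma lowered_minus:
  assumes "sublinear p" "c \<le> p d" shows "lowered p d c (- d) \<le> - c"
  \<comment> \<open>For \<open>s = 1\<close> the argument of \<open>p\<close> is 0.\<close>
  using lowered_le[OF assms, of 1 "- d"] sublinear_zero[OF assms(1)] by simp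

text \<open>Shifts are matched: \<open>s\<close> for \<open>u\<close> and \<open>r\<close> for
  \<open>v\<close> combine to \<open>s + r\<close> for \<open>u + v\<close>, and \<open>s\<close>
  for \<open>v\<close> becomes \<open>k * s\<close> for \<open>k *\<^sub>R v\<close>. The infima are
  then taken one at a time.\<close>

lemma sublinear_lowered:
  assumes p: "sublinear p" and c: "c \<le> p d"
  shows "sublinear (lowered p d c)"
proof -
  have add: "lowered p d c (u + v) \<le> lowered p d c u + lowered p d c v" for u v
  proof -
    have "lowered p d c (u + v) - lowered p d c v \<le> p (u + s *\<^sub>R d) - s * c" if s: "0 \<le> s" for s
    proof -
      have "lowered p d c (u + v) - (p (u + s *\<^sub>R d) - s * c) \<le> p (v + r *\<^sub>R d) - r * c"
        if r: "0 \<le> r" for r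
        using lowered_le[OF p c, of "s + r" "u + v"] r s
          sublinear_add[OF p, of "u + s *\<^sub>R d" "v + r *\<^sub>R d"]
        by (simp add: algebra_simps)
      then have "lowered p d c (u + v) - (p (u + s *\<^sub>R d) - s * c) \<le> lowered p d c v"
        by (rule lowered_ge)
      then show ?thesis by simp
    qed
    then have "lowered p d c (u + v) - lowered p d c v \<le> lowered p d c u"
      by (rule lowered_ge)
    then show ?thesis by simp
  qed
  have le: "lowered p d c (k *\<^sub>R v) \<le> k * lowered p d c v" if k: "0 < k" for k v
  proof -
    have "lowered p d c (k *\<^sub>R v) / k \<le> p (v + s *\<^sub>R d) - s * c" if s: "0 \<le> s" for s
    proof -
      have "lowered p d c (k *\<^sub>R v) \<le> p (k *\<^sub>R v + (k * s) *\<^sub>R d) - k * s * c"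
        using lowered_le[OF p c, of "k * s" "k *\<^sub>R v"] k s by simp
      also have "\<dots> = k * (p (v + s *\<^sub>R d) - s * c)"
        using sublinear_scale_pos[OF p k, of "v + s *\<^sub>R d"] by (simp add: algebra_simps)
      finally show ?thesis using k by (simp add: field_simps)
    qed
    then have "lowered p d c (k *\<^sub>R v) / k \<le> lowered p d c v" by (rule lowered_ge)
    then show ?thesis using k by (simp add: field_simps)
  qed
  have "lowered p d c (k *\<^sub>R v) = k * lowered p d c v" if k: "0 < k" for k v
  proof (rule antisym)
    show "k * lowered p d c v \<le> lowered p d c (k *\<^sub>R v)"
      using le[of "inverse k" "k *\<^sub>R v"] k by (simp add: field_simps)
  qed (rule le[OF k])
  with add show ?thesis by (simp add: sublinear_def)
qed

section \<open>Minimal sublinear functionals and the Hahn-Banach theorem\<close>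

lemma minimal_sublinear_linear:
  assumes q: "sublinear q" and min: "\<And>r. sublinear r \<Longrightarrow> r \<le> q \<Longrightarrow> r = q"
  shows "linear q"
proof -
  \<comment> \<open>Lowering \<open>q\<close> at \<open>a\<close> to the level \<open>q a\<close>
    gives a sublinear functional below \<open>q\<close>, so by minimality nothing changes. The bound
    at \<open>- a\<close> that lowering enforces makes \<open>q\<close> odd, and an odd sublinear
    functional is linear.\<close>
  have "lowered q a (q a) = q" for a
    by (rule min) (auto simp: q sublinear_lowered lowered_le_self le_fun_def)
  then have "q (- a) \<le> - q a" for a
    using lowered_minus[OF q, of "q a" a] by simp
  then have minus: "q (- a) = - q a" for a
    using sublinear_minus[OF q, of a] by (simp add: antisym minus_le_iff)
  show ?thesis
  proof (rule linearI)
    fix u v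
    show "q (u + v) = q u + q v"
      using sublinear_add[OF q, of u v] sublinear_add[OF q, of "- u" "- v"]
        minus[of "u + v"] minus[of u] minus[of v] by simp
  next
    fix k :: real and v
    show "q (k *\<^sub>R v) = k *\<^sub>R q v"
    proof (cases "0 \<le> k")
      case False
      then show ?thesis
        using sublinear_scale[OF q, of "- k" v] minus[of "k *\<^sub>R v"] by simp
    qed (simp add: sublinear_scale[OF q])
  qed
qed

lemma linear_below_sublinear:
  assumes p: "sublinear p"
  obtains q where "linear q" "q \<le> p"
proof -
  define A where "A = {r. sublinear r \<and> r \<le> p}"
  have "\<exists>m\<in>A. \<forall>a\<in>A. a \<le> m \<longrightarrow> a = m"
  proof (rule predicate_Zorn)
    \<comment> \<open>The order is reversed, so that Zorn's maximal element is a minimal functional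
      and chains need lower bounds.\<close>
    show "partial_order_on A (relation_of (\<lambda>a b. b \<le> a) A)"
      by (rule partial_order_on_relation_ofI) auto
  next
    fix K assume "K \<in> Chains (relation_of (\<lambda>a b. b \<le> a) A)"
    then have KA: "K \<subseteq> A" and total: "\<And>a b. a \<in> K \<Longrightarrow> b \<in> K \<Longrightarrow> a \<le> b \<or> b \<le> a"
      by (auto simp: Chains_def relation_of_def)
    show "\<exists>u\<in>A. \<forall>a\<in>K. u \<le> a"
    proof (cases "K = {}")
      case True
      then show ?thesis using p by (auto simp: A_def)
    next
      case False
      \<comment> \<open>The lower bound of a nonempty chain is its pointwise infimum, finite because
        all members satisfy \<open>- p (- v) \<le> r v\<close>.\<close>
      define m where "m v = (INF r\<in>K. r v)" for v
      have sub: "sublinear r" if "r \<in> K" for r using KA that by (auto simp: A_def)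
      have below: "- p (- v) \<le> r v" if "r \<in> K" for r v
      proof -
        have "r (- v) \<le> p (- v)" using KA that by (auto simp: A_def le_fun_def)
        then show ?thesis using sublinear_minus[OF sub[OF that], of v] by linarith
      qed
      have m_le: "m v \<le> r v" if "r \<in> K" for r v
        unfolding m_def using below that
        by (intro cINF_lower bdd_belowI2[where m = "- p (- v)"]) auto
      have m_ge: "b \<le> m v" if "\<And>r. r \<in> K \<Longrightarrow> b \<le> r v" for b v
        unfolding m_def by (intro cINF_greatest False that)
      have add: "m (u + v) \<le> m u + m v" for u v
      proof -
        have "m (u + v) - m v \<le> r u" if r: "r \<in> K" for r
        proof -
          have "m (u + v) - r u \<le> r' v" if r': "r' \<in> K" for r'
          proof -
            \<comment> \<open>Totality of the chain is essential for subadditivity: a single member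
              lies below both \<open>r\<close> and \<open>r'\<close>, and its own subadditivity can
              be used.\<close>
            obtain r'' where "r'' \<in> K" "r'' \<le> r" "r'' \<le> r'"
              using total[OF r r'] r r' by blast
            moreover from this have "m (u + v) \<le> r'' u + r'' v"
              using m_le[of r'' "u + v"] sublinear_add[OF sub, of r'' u v] by linarith
            moreover have "r'' u \<le> r u" "r'' v \<le> r' v"
              using \<open>r'' \<le> r\<close> \<open>r'' \<le> r'\<close> by (auto simp: le_fun_def)
            ultimately show ?thesis by linarith
          qed
          then have "m (u + v) - r u \<le> m v" by (rule m_ge)
          then show ?thesis by simp
        qed
        then have "m (u + v) - m v \<le> m u" by (rule m_ge)
        then show ?thesis by simp
      qed
      have le: "m (k *\<^sub>R v) \<le> k * m v" if k: "0 < k" for k v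
      proof -
        have "m (k *\<^sub>R v) / k \<le> m v"
        proof (rule m_ge)
          fix r assume "r \<in> K"
          then show "m (k *\<^sub>R v) / k \<le> r v"
            using m_le[of r "k *\<^sub>R v"] sublinear_scale_pos[OF sub k, of r v] k
            by (simp add: field_simps)
        qed
        then show ?thesis using k by (simp add: field_simps)
      qed
      have "m (k *\<^sub>R v) = k * m v" if k: "0 < k" for k v
      proof (rule antisym)
        show "k * m v \<le> m (k *\<^sub>R v)"
          using le[of "inverse k" "k *\<^sub>R v"] k by (simp add: field_simps)
      qed (rule le[OF k])
      then have "sublinear m" using add by (simp add: sublinear_def)
      moreover have "m \<le> p"
      proof (rule le_funI)
        fix v
        obtain r where "r \<in> K" "r \<le> p" using False KA by (auto simp: A_def)
        then show "m v \<le> p v" using m_le[of r v] le_funD[of r p v] by linarith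
      qed
      ultimately show ?thesis using m_le by (auto simp: A_def le_fun_def)
    qed
  qed
  then obtain q where "q \<in> A" and q: "\<And>a. a \<in> A \<Longrightarrow> a \<le> q \<Longrightarrow> a = q" by blast
  then have "sublinear q" "q \<le> p" by (auto simp: A_def)
  moreover have "linear q"
    by (rule minimal_sublinear_linear)
      (use calculation q order_trans[of _ q p] in \<open>auto simp: A_def\<close>)
  ultimately show ?thesis using that by blast
qed

text \<open>Lowering twice pins the value at \<open>d\<close>. The first lowering puts
  \<open>p1 (- d)\<close> at most \<open>- c\<close>, which forces \<open>q d \<ge> c\<close>; the
  second, in direction \<open>- d\<close>, puts \<open>p2 d\<close> at most \<open>c\<close>, which
  forces \<open>q d \<le> c\<close>.\<close>

theorem hahn_banach_point:
  assumes p: "sublinear p" and c: "c \<le> p d" and c': "- c \<le> p (- d)"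
  obtains q where "linear q" "q \<le> p" "q d = c"
proof -
  define p1 where "p1 = lowered p d c"
  have p1: "sublinear p1" unfolding p1_def by (rule sublinear_lowered[OF p c])
  \<comment> \<open>The second lowering requires \<open>- c \<le> p1 (- d)\<close>. The vector
    \<open>- d + s *\<^sub>R d\<close> is a nonnegative multiple of \<open>d\<close> if
    \<open>s \<ge> 1\<close> and of \<open>- d\<close> otherwise, so either \<open>c\<close> or
    \<open>c'\<close> applies.\<close>
  have "- c \<le> p (- d + s *\<^sub>R d) - s * c" if "0 \<le> s" for s
  proof (cases "1 \<le> s")
    case True
    have "(s - 1) * c \<le> (s - 1) * p d" using True c by (simp add: mult_left_mono)
    also have "\<dots> = p (- d + s *\<^sub>R d)"
      using True sublinear_scale[OF p, of "s - 1" d] by (simp add: algebra_simps)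
    finally show ?thesis by (simp add: algebra_simps)
  next
    case False
    have "(1 - s) * - c \<le> (1 - s) * p (- d)" using False c' by (intro mult_left_mono) auto
    also have "\<dots> = p (- d + s *\<^sub>R d)"
      using False sublinear_scale[OF p, of "1 - s" "- d"] by (simp add: algebra_simps)
    finally show ?thesis by (simp add: algebra_simps)
  qed
  then have c1: "- c \<le> p1 (- d)" unfolding p1_def by (rule lowered_ge)
  define p2 where "p2 = lowered p1 (- d) (- c)"
  have "sublinear p2" unfolding p2_def by (rule sublinear_lowered[OF p1 c1])
  then obtain q where q: "linear q" "q \<le> p2" by (rule linear_below_sublinear)
  have p21: "p2 v \<le> p1 v" for v unfolding p2_def by (rule lowered_le_self[OF p1 c1])
  have p10: "p1 v \<le> p v" for v unfolding p1_def by (rule lowered_le_self[OF p c])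
  have "q v \<le> p1 v" for v using le_funD[OF q(2), of v] p21[of v] by linarith
  moreover have "q d \<le> c"
    using le_funD[OF q(2), of d] lowered_minus[OF p1 c1] by (simp add: p2_def)
  moreover have "- q d \<le> - c"
    using calculation(1)[of "- d"] lowered_minus[OF p c] linear_neg[OF q(1), of d]
    by (simp add: p1_def)
  moreover have "q \<le> p"
    using calculation(1) p10 order_trans by (intro le_funI) blast
  ultimately show ?thesis using that[of q] q(1) by simp
qed

section \<open>An interior extremum, as in Rolle's theorem\<close>

lemma rolle_extremum:
  fixes g :: "real \<Rightarrow> real"
  assumes cont: "continuous_on {a..b} g" and "a < b" and eq: "g a = g b"
  obtains s where "a < s" "s < b" "(\<forall>t\<in>{a..b}. g t \<le> g s) \<or> (\<forall>t\<in>{a..b}. g s \<le> g t)"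
proof -
  have ne: "{a..b} \<noteq> {}" using \<open>a < b\<close> by simp
  obtain M where M: "M \<in> {a..b}" "\<forall>t\<in>{a..b}. g t \<le> g M"
    using continuous_attains_sup[OF compact_Icc ne cont] by blast
  obtain m where m: "m \<in> {a..b}" "\<forall>t\<in>{a..b}. g m \<le> g t"
    using continuous_attains_inf[OF compact_Icc ne cont] by blast
  consider "a < M \<and> M < b" | "a < m \<and> m < b" | "M \<in> {a, b}" "m \<in> {a, b}"
    using M(1) m(1) by fastforce
  then show ?thesis
  proof cases
    \<comment> \<open>Maximum and minimum are both attained at endpoints, so \<open>g\<close> is
      constant and the midpoint serves.\<close>
    case 3
    then have "g M = g a" "g m = g a" using eq by auto
    then have "g t \<le> g ((a + b) / 2)" if "t \<in> {a..b}" for t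
    proof -
      have "g t \<le> g a" using M(2) that \<open>g M = g a\<close> by simp
      also have "\<dots> \<le> g ((a + b) / 2)" using m(2) \<open>g m = g a\<close> \<open>a < b\<close> by simp
      finally show ?thesis .
    qed
    then show ?thesis using that[of "(a + b) / 2"] \<open>a < b\<close> by auto
  qed (use that M m in blast)+
qed

section \<open>The Minkowski functional\<close>

locale symmetric_convex =
  fixes C :: "'a::real_vector set" and x0 :: 'a
  assumes conv: "convex C" and x0_in: "x0 \<in> C" and sym: "symmetric_wrt C x0"
begin

abbreviation D :: "'a set" where "D \<equiv> translated C x0"
abbreviation X :: "'a set" where "X \<equiv> dir_space C x0"
abbreviation \<mu> :: "'a \<Rightarrow> real" where "\<mu> \<equiv> minkowski C x0"

lemma D_iff: "w \<in> D \<longleftrightarrow> x0 + w \<in> C"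
  by (auto simp: translated_def intro: image_eqI[of _ _ "x0 + w"])

lemma convex_D: "convex D"
  unfolding translated_def using convex_translation[OF conv, of "- x0"] by (simp add: algebra_simps)

lemma zero_in_D: "0 \<in> D"
  using x0_in by (simp add: D_iff)

lemma minus_in_D: "w \<in> D \<Longrightarrow> - w \<in> D"
  using sym unfolding symmetric_wrt_def by blast

lemma scale_in_D: "w \<in> D \<Longrightarrow> 0 \<le> k \<Longrightarrow> k \<le> 1 \<Longrightarrow> k *\<^sub>R w \<in> D"
  using convexD[OF convex_D, of w 0 k "1 - k"] zero_in_D by simp

text \<open>The vector \<open>w''\<close> is the convex combination of \<open>w\<close> and
  \<open>w'\<close> with weights proportional to \<open>s\<close> and \<open>t\<close>. This one
  fact makes the cone over \<open>D\<close> additive and gives the triangle inequality for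
  \<open>\<mu>\<close>.\<close>

lemma cone_add_D:
  assumes "w \<in> D" "w' \<in> D" "0 < s" "0 < t"
  obtains w'' where "w'' \<in> D" "s *\<^sub>R w + t *\<^sub>R w' = (s + t) *\<^sub>R w''"
proof
  show "(s / (s + t)) *\<^sub>R w + (t / (s + t)) *\<^sub>R w' \<in> D"
    using assms by (intro convexD[OF convex_D]) (auto simp: add_divide_distrib[symmetric])
  show "s *\<^sub>R w + t *\<^sub>R w' = (s + t) *\<^sub>R ((s / (s + t)) *\<^sub>R w + (t / (s + t)) *\<^sub>R w')"
    using assms by (simp add: scaleR_right_distrib)
qed

lemma subspace_X: "subspace X"
  by (simp add: dir_space_def)

lemma D_subset_X: "w \<in> D \<Longrightarrow> w \<in> X"
  by (simp add: dir_space_def span_base)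

text \<open>The cone over \<open>D\<close> is already a subspace, with symmetry supplying the
  negative multiples, so it contains the span. Hence the infimum defining \<open>\<mu>\<close> is
  over a nonempty set on \<open>X\<close>.\<close>

lemma X_absorbed:
  assumes "v \<in> X" obtains t w where "0 < t" "w \<in> D" "v = t *\<^sub>R w"
proof -
  define S where "S = {t *\<^sub>R w | t w. 0 < t \<and> w \<in> D}"
  have "subspace S"
  proof (rule subspaceI)
    show "0 \<in> S" using zero_in_D by (force simp: S_def intro: exI[of _ 1])
  next
    fix u v assume "u \<in> S" "v \<in> S"
    then obtain s w t w' where *: "u = s *\<^sub>R w" "v = t *\<^sub>R w'" "0 < s" "0 < t" "w \<in> D" "w' \<in> D"
      by (auto simp: S_def)
    then show "u + v \<in> S"
      using cone_add_D[of w w' s t] by (force simp: S_def intro: exI[of _ "s + t"])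
  next
    fix c :: real and v assume "v \<in> S"
    then obtain t w where *: "v = t *\<^sub>R w" "0 < t" "w \<in> D" by (auto simp: S_def)
    consider "c = 0" | "c > 0" | "c < 0" by linarith
    then show "c *\<^sub>R v \<in> S"
    proof cases
      case 1
      then show ?thesis using zero_in_D by (force simp: S_def intro: exI[of _ 1])
    next
      case 2
      then have "c *\<^sub>R v = (c * t) *\<^sub>R w" "0 < c * t" using * by auto
      then show ?thesis using *(3) unfolding S_def by blast
    next
      case 3
      then have "c *\<^sub>R v = (- c * t) *\<^sub>R (- w)" "0 < - c * t" using * by (auto simp: mult_less_0_iff)
      then show ?thesis using minus_in_D[OF *(3)] unfolding S_def by blast
    qed
  qed
  moreover have "D \<subseteq> S" by (force simp: S_def intro: exI[of _ 1])
  ultimately have "X \<subseteq> S" unfolding dir_space_def by (rule span_minimal[rotated])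
  then show ?thesis using assms that by (auto simp: S_def)
qed

lemma minkowski_le: "0 < t \<Longrightarrow> w \<in> D \<Longrightarrow> \<mu> (t *\<^sub>R w) \<le> t"
  unfolding minkowski_def by (rule cInf_lower) (auto intro!: bdd_belowI[of _ 0])

lemma minkowski_nonneg:
  assumes "v \<in> X" shows "0 \<le> \<mu> v"
proof -
  obtain t w where "0 < t" "w \<in> D" "v = t *\<^sub>R w" using X_absorbed[OF assms] .
  then show ?thesis unfolding minkowski_def by (intro cInf_greatest) auto
qed

text \<open>The admissible factors are upward closed because \<open>D\<close> is star-shaped about
  0, so every \<open>s\<close> above the infimum is itself admissible.\<close>

lemma minkowski_lessD:
  assumes "v \<in> X" "\<mu> v < s" obtains w where "w \<in> D" "v = s *\<^sub>R w"
proof -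
  obtain t' w' where "0 < t'" "w' \<in> D" "v = t' *\<^sub>R w'" using X_absorbed[OF assms(1)] .
  then have "{t. 0 < t \<and> v \<in> (\<lambda>w. t *\<^sub>R w) ` D} \<noteq> {}" by blast
  then obtain t w where t: "0 < t" "t < s" "w \<in> D" "v = t *\<^sub>R w"
    using cInf_lessD[OF _ assms(2)[unfolded minkowski_def]] by blast
  show ?thesis
  proof
    show "(t / s) *\<^sub>R w \<in> D" using t by (intro scale_in_D) auto
    show "v = s *\<^sub>R ((t / s) *\<^sub>R w)" using t by simp
  qed
qed

lemma minkowski_triangle:
  assumes "u \<in> X" "v \<in> X" shows "\<mu> (u + v) \<le> \<mu> u + \<mu> v"
proof (rule field_le_epsilon)
  fix e :: real assume e: "0 < e"
  obtain w where w: "w \<in> D" "u = (\<mu> u + e / 2) *\<^sub>R w"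
    using minkowski_lessD[OF assms(1), of "\<mu> u + e / 2"] e by auto
  obtain w' where w': "w' \<in> D" "v = (\<mu> v + e / 2) *\<^sub>R w'"
    using minkowski_lessD[OF assms(2), of "\<mu> v + e / 2"] e by auto
  have pos: "0 < \<mu> u + e / 2" "0 < \<mu> v + e / 2"
    using minkowski_nonneg assms e by (auto intro: add_nonneg_pos)
  obtain w'' where "w'' \<in> D" "u + v = (\<mu> u + e / 2 + (\<mu> v + e / 2)) *\<^sub>R w''"
    using cone_add_D[OF w(1) w'(1) pos] w(2) w'(2) by metis
  then show "\<mu> (u + v) \<le> \<mu> u + \<mu> v + e"
    using minkowski_le[of "\<mu> u + e / 2 + (\<mu> v + e / 2)" w''] pos by simp
qed

lemma minkowski_zero: "\<mu> 0 = 0"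
proof (rule antisym)
  show "\<mu> 0 \<le> 0"
    by (rule field_le_epsilon) (use minkowski_le[OF _ zero_in_D] in simp)
qed (simp add: minkowski_nonneg subspace_0[OF subspace_X])

lemma minkowski_scale_le:
  assumes "v \<in> X" shows "\<mu> (c *\<^sub>R v) \<le> \<bar>c\<bar> * \<mu> v"
proof (cases "c = 0")
  case False
  show ?thesis
  proof (rule field_le_epsilon)
    fix e :: real assume e: "0 < e"
    \<comment> \<open>The slack is \<open>e / \<bar>c\<bar>\<close> so that multiplying by
      \<open>\<bar>c\<bar>\<close> leaves \<open>e\<close>. The sign of \<open>c\<close> is moved
      onto \<open>w\<close>, which symmetry of \<open>D\<close> permits.\<close>
    define s where "s = \<mu> v + e / \<bar>c\<bar>"
    have "\<mu> v < s" using e False by (simp add: s_def)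
    then obtain w where w: "w \<in> D" "v = s *\<^sub>R w" using minkowski_lessD[OF assms] by blast
    have "0 < s" using \<open>\<mu> v < s\<close> minkowski_nonneg[OF assms] by simp
    have "c *\<^sub>R v = (\<bar>c\<bar> * s) *\<^sub>R (if c < 0 then - w else w)" by (simp add: w(2))
    then have "\<mu> (c *\<^sub>R v) \<le> \<bar>c\<bar> * s"
      using minkowski_le[of "\<bar>c\<bar> * s" "if c < 0 then - w else w"] w(1) minus_in_D \<open>0 < s\<close> False
      by simp
    then show "\<mu> (c *\<^sub>R v) \<le> \<bar>c\<bar> * \<mu> v + e" using False by (simp add: s_def distrib_left)
  qed
qed (simp add: minkowski_zero)

section \<open>The open unit ball of the seminorm\<close>

abbreviation ball :: "'a set" where "ball \<equiv> minkowski_unit_ball C x0"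

lemma ball_iff: "z \<in> ball \<longleftrightarrow> z - x0 \<in> X \<and> \<mu> (z - x0) < 1"
proof -
  have "z \<in> (\<lambda>w. x0 + w) ` X \<longleftrightarrow> z - x0 \<in> X"
    by (auto intro: image_eqI[of _ _ "z - x0"])
  then show ?thesis by (simp add: minkowski_unit_ball_def)
qed

lemma C_diff_in_X:
  assumes "z \<in> C" "z' \<in> C" shows "z - z' \<in> X"
proof -
  have "z - x0 \<in> X" "z' - x0 \<in> X" using assms by (auto intro: D_subset_X simp: D_iff)
  then have "(z - x0) - (z' - x0) \<in> X" by (rule subspace_diff[OF subspace_X])
  then show ?thesis by simp
qed

lemma ball_in_C:
  assumes "z \<in> ball" shows "z \<in> C"
proof -
  obtain w where "w \<in> D" "z - x0 = 1 *\<^sub>R w"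
    using assms minkowski_lessD[of "z - x0" 1] unfolding ball_iff by blast
  then show ?thesis by (auto simp: D_iff diff_eq_eq add.commute)
qed

lemma convex_ball: "convex ball"
proof (rule convexI)
  fix x y and u v :: real
  assume *: "x \<in> ball" "y \<in> ball" "0 \<le> u" "0 \<le> v" "u + v = 1"
  have eq: "u *\<^sub>R x + v *\<^sub>R y - x0 = u *\<^sub>R (x - x0) + v *\<^sub>R (y - x0)"
    using *(5) by (simp add: algebra_simps) (metis scaleR_left_distrib scaleR_one)
  have X: "x - x0 \<in> X" "y - x0 \<in> X" using * by (auto simp: ball_iff)
  have "\<mu> (u *\<^sub>R (x - x0) + v *\<^sub>R (y - x0)) \<le> \<mu> (u *\<^sub>R (x - x0)) + \<mu> (v *\<^sub>R (y - x0))"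
    by (intro minkowski_triangle subspace_scale[OF subspace_X] X)
  also have "\<dots> \<le> u * \<mu> (x - x0) + v * \<mu> (y - x0)"
    using minkowski_scale_le[OF X(1), of u] minkowski_scale_le[OF X(2), of v] * by simp
  also have "\<dots> < 1"
    using *(1,2) by (intro convex_bound_lt) (use * in \<open>auto simp: ball_iff\<close>)
  finally show "u *\<^sub>R x + v *\<^sub>R y \<in> ball"
    unfolding ball_iff eq using X
    by (auto intro!: subspace_add[OF subspace_X] subspace_scale[OF subspace_X])
qed

text \<open>The triangle inequality leaves the margin \<open>1 - \<mu> (z - x0)\<close>. It keeps
  shifted base points inside the domain of the function.\<close>

lemma ball_interior:
  assumes "z \<in> ball" "u \<in> X" "\<mu> u < 1 - \<mu> (z - x0)"
  shows "z + u \<in> C"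
proof (rule ball_in_C)
  have "z + u - x0 = (z - x0) + u" by simp
  then show "z + u \<in> ball"
    using assms minkowski_triangle[of "z - x0" u] subspace_add[OF subspace_X, of "z - x0" u]
    by (simp only: ball_iff) auto
qed

section \<open>The Clarke derivative\<close>

abbreviation base_filter :: "'a \<Rightarrow> ('a \<times> real) filter" where
  "base_filter z \<equiv> minkowski_nhds C x0 z \<times>\<^sub>F at_right 0"

lemma eventually_minkowski_nhds:
  assumes z: "z \<in> C"
  shows "eventually P (minkowski_nhds C x0 z) \<longleftrightarrow> (\<exists>e>0. \<forall>y\<in>C. \<mu> (y - z) < e \<longrightarrow> P y)"
proof -
  have "(\<exists>Q. eventually Q (nhds 0) \<and> (\<forall>y. Q (\<mu> (y - z)) \<longrightarrow> y \<in> C \<longrightarrow> P y)) \<longleftrightarrow>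
    (\<exists>e>0. \<forall>y\<in>C. \<mu> (y - z) < e \<longrightarrow> P y)"
  proof safe
    fix Q :: "real \<Rightarrow> bool"
    assume Q: "eventually Q (nhds 0)" "\<forall>y. Q (\<mu> (y - z)) \<longrightarrow> y \<in> C \<longrightarrow> P y"
    then obtain e where "e > 0" "\<And>t. \<bar>t\<bar> < e \<Longrightarrow> Q t"
      by (auto simp: eventually_nhds_metric dist_real_def)
    \<comment> \<open>Neighbourhoods of 0 are two-sided, but \<open>\<mu>\<close> is nonnegative on
      differences of points of \<open>C\<close>, so only the upper bound remains.\<close>
    then show "\<exists>e>0. \<forall>y\<in>C. \<mu> (y - z) < e \<longrightarrow> P y"
      using Q(2) minkowski_nonneg C_diff_in_X[OF _ z] by (intro exI[of _ e]) auto
  next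
    fix e :: real assume "e > 0" "\<forall>y\<in>C. \<mu> (y - z) < e \<longrightarrow> P y"
    then show "\<exists>Q. eventually Q (nhds 0) \<and> (\<forall>y. Q (\<mu> (y - z)) \<longrightarrow> y \<in> C \<longrightarrow> P y)"
      using eventually_nhds_in_open[of "{..<e}" 0]
      by (intro exI[of _ "\<lambda>t. t < e"]) auto
  qed
  then show ?thesis
    unfolding minkowski_nhds_def eventually_inf_principal eventually_filtercomap by auto
qed

lemma eventually_base_filter:
  assumes z: "z \<in> C"
  shows "eventually P (base_filter z) \<longleftrightarrow>
    (\<exists>e>0. \<forall>y\<in>C. \<forall>t. \<mu> (y - z) < e \<longrightarrow> 0 < t \<longrightarrow> t < e \<longrightarrow> P (y, t))"
proof
  assume "eventually P (base_filter z)"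
  then obtain Q R where QR: "eventually Q (minkowski_nhds C x0 z)" "eventually R (at_right (0::real))"
    "\<And>y t. Q y \<Longrightarrow> R t \<Longrightarrow> P (y, t)"
    by (auto simp: eventually_prod_filter)
  obtain e where e: "e > 0" "\<And>y. y \<in> C \<Longrightarrow> \<mu> (y - z) < e \<Longrightarrow> Q y"
    using QR(1) by (auto simp: eventually_minkowski_nhds[OF z])
  obtain b where b: "b > 0" "\<And>t. 0 < t \<Longrightarrow> t < b \<Longrightarrow> R t"
    using QR(2) by (auto simp: eventually_at_right_field)
  show "\<exists>e>0. \<forall>y\<in>C. \<forall>t. \<mu> (y - z) < e \<longrightarrow> 0 < t \<longrightarrow> t < e \<longrightarrow> P (y, t)"
    using e b QR(3) by (intro exI[of _ "min e b"]) auto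
next
  assume "\<exists>e>0. \<forall>y\<in>C. \<forall>t. \<mu> (y - z) < e \<longrightarrow> 0 < t \<longrightarrow> t < e \<longrightarrow> P (y, t)"
  then obtain e where e: "e > 0"
    "\<And>y t. y \<in> C \<Longrightarrow> \<mu> (y - z) < e \<Longrightarrow> 0 < t \<Longrightarrow> t < e \<Longrightarrow> P (y, t)" by blast
  show "eventually P (base_filter z)"
    unfolding eventually_prod_filter
  proof (intro exI conjI allI impI)
    show "eventually (\<lambda>y. y \<in> C \<and> \<mu> (y - z) < e) (minkowski_nhds C x0 z)"
      using e(1) by (auto simp: eventually_minkowski_nhds[OF z])
    show "eventually (\<lambda>t. 0 < t \<and> t < e) (at_right (0::real))"
      using e(1) by (auto simp: eventually_at_right_field)
  qed (use e(2) in auto)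
qed

text \<open>The pairs \<open>(z, t)\<close> with small \<open>t > 0\<close> meet every condition of
  the filter.\<close>

lemma base_filter_nontrivial: "z \<in> C \<Longrightarrow> base_filter z \<noteq> bot"
  using dense[of "0::real"] minkowski_zero
  by (force simp: trivial_limit_def eventually_base_filter)

text \<open>Moving the base point from \<open>y\<close> to \<open>y + t *\<^sub>R w\<close> respects
  the limit. This is what permits splitting a quotient in direction \<open>v + w\<close> at the
  intermediate point.\<close>

lemma filterlim_step:
  assumes z: "z \<in> ball" and w: "w \<in> X"
  shows "filterlim (\<lambda>(y, t). (y + t *\<^sub>R w, t)) (base_filter z) (base_filter z)"
  unfolding filterlim_iff
proof (intro allI impI)
  fix P :: "'a \<times> real \<Rightarrow> bool" assume "eventually P (base_filter z)"
  then obtain e where e: "e > 0"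
    "\<And>y t. y \<in> C \<Longrightarrow> \<mu> (y - z) < e \<Longrightarrow> 0 < t \<Longrightarrow> t < e \<Longrightarrow> P (y, t)"
    using eventually_base_filter[OF ball_in_C[OF z]] by metis
  \<comment> \<open>The bound \<open>e\<close> serves the predicate and
    \<open>1 - \<mu> (z - x0)\<close> keeps the moved point in \<open>C\<close>. The denominator in
    \<open>d\<close> is positive and gives \<open>d + d * \<mu> w < k\<close> as well as
    \<open>d \<le> k\<close>.\<close>
  define k where "k = min e (1 - \<mu> (z - x0))"
  define d where "d = k / (\<mu> w + 2)"
  have k: "0 < k" using e z by (simp add: k_def ball_iff)
  have w0: "0 \<le> \<mu> w" by (rule minkowski_nonneg[OF w])
  have d: "0 < d" and "d * (\<mu> w + 2) = k" using k w0 by (auto simp: d_def)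
  then have dk: "d * \<mu> w + 2 * d = k" by (simp add: algebra_simps)
  have "P (y + t *\<^sub>R w, t)" if y: "y \<in> C" "\<mu> (y - z) < d" and t: "0 < t" "t < d" for y t
  proof -
    have X: "y - z \<in> X" "t *\<^sub>R w \<in> X"
      using C_diff_in_X[OF y(1) ball_in_C[OF z]] subspace_scale[OF subspace_X w] by auto
    have "\<mu> (t *\<^sub>R w) \<le> t * \<mu> w" using minkowski_scale_le[OF w, of t] t by simp
    also have "\<dots> \<le> d * \<mu> w" using t w0 by (simp add: mult_right_mono)
    finally have "\<mu> ((y - z) + t *\<^sub>R w) < k"
      using minkowski_triangle[OF X] dk d y by simp
    then have *: "\<mu> ((y - z) + t *\<^sub>R w) < e" "\<mu> ((y - z) + t *\<^sub>R w) < 1 - \<mu> (z - x0)"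
      by (auto simp: k_def)
    have "z + ((y - z) + t *\<^sub>R w) \<in> C"
      by (rule ball_interior[OF z subspace_add[OF subspace_X X] *(2)])
    moreover have "d \<le> k" using dk d mult_nonneg_nonneg[of d "\<mu> w"] w0 by linarith
    then have "t < e" using t by (simp add: k_def)
    ultimately show ?thesis using e(2)[of "y + t *\<^sub>R w" t] *(1) t by (simp add: algebra_simps)
  qed
  then show "eventually (\<lambda>a. P (case a of (y, t) \<Rightarrow> (y + t *\<^sub>R w, t))) (base_filter z)"
    using d by (auto simp: eventually_base_filter[OF ball_in_C[OF z]])
qed

lemma eventually_in_C: "z \<in> C \<Longrightarrow> eventually (\<lambda>(y, t). y \<in> C \<and> 0 < t) (base_filter z)"
  by (auto simp: eventually_base_filter intro: exI[of _ 1])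

end

section \<open>Finiteness and sublinearity of the Clarke derivative\<close>

abbreviation quotient :: "('a::real_vector \<Rightarrow> real) \<Rightarrow> 'a \<Rightarrow> 'a \<times> real \<Rightarrow> real" where
  "quotient \<phi> v \<equiv> \<lambda>(y, t). (\<phi> (y + t *\<^sub>R v) - \<phi> y) / t"

locale lipschitz_on_symmetric = symmetric_convex C x0
  for C :: "'a::real_vector set" and x0 :: 'a +
  fixes \<phi> :: "'a \<Rightarrow> real" and L :: real
  assumes L_pos: "0 < L" and lip: "minkowski_lipschitz L C x0 \<phi>"
begin

abbreviation p :: "'a \<Rightarrow> 'a \<Rightarrow> ereal" where "p \<equiv> clarke_derivative C x0 \<phi>"

lemma p_eq_Limsup: "p z v = Limsup (base_filter z) (\<lambda>a. ereal (quotient \<phi> v a))"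
  unfolding clarke_derivative_def by (rule arg_cong2[of _ _ _ _ Limsup]) auto

lemma eventually_quotient_less:
  assumes "p z v < ereal r" shows "eventually (\<lambda>a. quotient \<phi> v a < r) (base_filter z)"
  using Limsup_lessD[OF assms[unfolded p_eq_Limsup]] by simp

lemma p_le:
  assumes "eventually (\<lambda>a. quotient \<phi> v a \<le> r) (base_filter z)" shows "p z v \<le> ereal r"
  unfolding p_eq_Limsup using assms by (intro Limsup_bounded) simp

lemma quotient_bound:
  assumes z: "z \<in> ball" and v: "v \<in> X"
  shows "eventually (\<lambda>a. \<bar>quotient \<phi> v a\<bar> \<le> L * \<mu> v) (base_filter z)"
proof -
  have "eventually (\<lambda>(y, t). y \<in> C \<and> 0 < t) (base_filter z)"
    by (rule eventually_in_C[OF ball_in_C[OF z]])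
  \<comment> \<open>Membership in \<open>C\<close> is pulled back along the step, so that the
    Lipschitz bound applies at both ends; the factor \<open>t\<close> then cancels.\<close>
  moreover have "eventually (\<lambda>(y, t). y + t *\<^sub>R v \<in> C) (base_filter z)"
    using filterlim_iff[THEN iffD1, OF filterlim_step[OF z v], rule_format, OF calculation]
    by (rule eventually_mono) auto
  ultimately show ?thesis
  proof eventually_elim
    case (elim a)
    obtain y t where a: "a = (y, t)" by fastforce
    have t: "0 < t" and C: "y \<in> C" "y + t *\<^sub>R v \<in> C" using elim by (auto simp: a)
    have "\<bar>\<phi> (y + t *\<^sub>R v) - \<phi> y\<bar> \<le> L * \<mu> (t *\<^sub>R v)"
      using lip C unfolding minkowski_lipschitz_def by fastforce
    also have "\<dots> \<le> L * (t * \<mu> v)"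
      using minkowski_scale_le[OF v, of t] t L_pos by simp
    finally show ?case using t by (simp add: a abs_divide field_simps)
  qed
qed

text \<open>The conversion to a real loses nothing for \<open>z\<close> in the ball and
  \<open>v\<close> in \<open>X\<close>: the quotients are eventually bounded by
  \<open>L * \<mu> v\<close>, and the filter is nontrivial.\<close>

definition P :: "'a \<Rightarrow> 'a \<Rightarrow> real" where "P z v = real_of_ereal (p z v)"

lemma p_eq_P:
  assumes z: "z \<in> ball" and v: "v \<in> X"
  shows "p z v = ereal (P z v)"
proof -
  have "p z v \<le> ereal (L * \<mu> v)"
    by (rule p_le, rule eventually_mono[OF quotient_bound[OF assms]]) (rule abs_le_D1)
  moreover have "ereal (- (L * \<mu> v)) \<le> p z v"
  proof (rule ccontr)
    assume "\<not> ?thesis"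
    then have "eventually (\<lambda>a. quotient \<phi> v a < - (L * \<mu> v)) (base_filter z)"
      by (intro eventually_quotient_less) simp
    with quotient_bound[OF assms] have "eventually (\<lambda>a. False) (base_filter z)"
      by eventually_elim auto
    then show False
      using base_filter_nontrivial[OF ball_in_C[OF z]] by (simp add: trivial_limit_def)
  qed
  ultimately show ?thesis unfolding P_def by (cases "p z v") auto
qed

text \<open>The quotient in direction \<open>v + w\<close> at \<open>(y, t)\<close> is the one for
  \<open>v\<close> at \<open>(y + t *\<^sub>R w, t)\<close> plus the one for \<open>w\<close> at
  \<open>(y, t)\<close>.\<close>

lemma P_add:
  assumes z: "z \<in> ball" and v: "v \<in> X" and w: "w \<in> X"
  shows "P z (v + w) \<le> P z v + P z w"
proof (rule field_le_epsilon)
  fix e :: real assume e: "0 < e"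
  have "eventually (\<lambda>a. quotient \<phi> v a < P z v + e / 2) (base_filter z)"
    by (rule eventually_quotient_less) (use e in \<open>simp add: p_eq_P[OF z v]\<close>)
  from filterlim_iff[THEN iffD1, OF filterlim_step[OF z w], rule_format, OF this]
  have "eventually (\<lambda>(y, t). quotient \<phi> v (y + t *\<^sub>R w, t) < P z v + e / 2) (base_filter z)"
    by (rule eventually_mono) auto
  moreover have "eventually (\<lambda>a. quotient \<phi> w a < P z w + e / 2) (base_filter z)"
    by (rule eventually_quotient_less) (use e in \<open>simp add: p_eq_P[OF z w]\<close>)
  ultimately have "eventually (\<lambda>a. quotient \<phi> (v + w) a \<le> P z v + P z w + e) (base_filter z)"
  proof eventually_elim
    case (elim a)
    obtain y t where a: "a = (y, t)" by fastforce
    have "quotient \<phi> (v + w) a = quotient \<phi> v (y + t *\<^sub>R w, t) + quotient \<phi> w a"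
      by (simp add: a add_divide_distrib[symmetric] algebra_simps)
    then show ?case using elim by (simp add: a)
  qed
  then have "p z (v + w) \<le> ereal (P z v + P z w + e)" by (rule p_le)
  then show "P z (v + w) \<le> P z v + P z w + e"
    by (simp add: p_eq_P[OF z subspace_add[OF subspace_X v w]])
qed

lemma P_scale_le:
  assumes z: "z \<in> ball" and v: "v \<in> X" and k: "0 < k"
  shows "P z (k *\<^sub>R v) \<le> k * P z v"
proof (rule field_le_epsilon)
  fix e :: real assume e: "0 < e"
  have "eventually (\<lambda>a. quotient \<phi> v a < P z v + e / k) (base_filter z)"
    by (rule eventually_quotient_less) (use e k in \<open>simp add: p_eq_P[OF z v]\<close>)
  then obtain d where d: "0 < d" "\<And>y t. y \<in> C \<Longrightarrow> \<mu> (y - z) < d \<Longrightarrow> 0 < t \<Longrightarrow> t < d \<Longrightarrow>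
      quotient \<phi> v (y, t) < P z v + e / k"
    unfolding eventually_base_filter[OF ball_in_C[OF z]] by blast
  have "eventually (\<lambda>a. quotient \<phi> (k *\<^sub>R v) a \<le> k * P z v + e) (base_filter z)"
    unfolding eventually_base_filter[OF ball_in_C[OF z]]
  \<comment> \<open>The quotient for \<open>k *\<^sub>R v\<close> at step \<open>t\<close> is
    \<open>k\<close> times that for \<open>v\<close> at step \<open>t * k\<close>, so both
    \<open>t\<close> and \<open>t * k\<close> have to be controlled.\<close>
  proof (intro exI[of _ "min d (d / k)"] conjI ballI allI impI)
    fix y t assume y: "y \<in> C" "\<mu> (y - z) < min d (d / k)" and t: "0 < t" "t < min d (d / k)"
    have "t * k < d" using t k by (simp add: field_simps)
    then have "quotient \<phi> v (y, t * k) < P z v + e / k" using y t k by (intro d(2)) auto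
    then have "k * quotient \<phi> v (y, t * k) < k * (P z v + e / k)"
      using k by (rule mult_strict_left_mono)
    then show "quotient \<phi> (k *\<^sub>R v) (y, t) \<le> k * P z v + e"
      using k t by (simp add: distrib_left)
  qed (use d k in auto)
  then have "p z (k *\<^sub>R v) \<le> ereal (k * P z v + e)" by (rule p_le)
  then show "P z (k *\<^sub>R v) \<le> k * P z v + e"
    by (simp add: p_eq_P[OF z subspace_scale[OF subspace_X v]])
qed

lemma P_scale:
  assumes z: "z \<in> ball" and v: "v \<in> X" and k: "0 < k"
  shows "P z (k *\<^sub>R v) = k * P z v"
proof (rule antisym)
  show "k * P z v \<le> P z (k *\<^sub>R v)"
    using P_scale_le[OF z subspace_scale[OF subspace_X v, of k], of "inverse k"] k
    by (simp add: field_simps)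
qed (rule P_scale_le[OF assms])

text \<open>A limit superior is bounded below along any family that enters every set of the filter.
  Here the family is the ray \<open>z + s *\<^sub>R a\<close> with step \<open>s\<close>; later
  \<open>a\<close> is \<open>d\<close>, \<open>- d\<close> or 0.\<close>

lemma P_ge:
  assumes z: "z \<in> ball" and v: "v \<in> X" and a: "a \<in> X" and "0 < \<delta>"
    and ge: "\<And>s. 0 < s \<Longrightarrow> s < \<delta> \<Longrightarrow> z + s *\<^sub>R a \<in> C \<and> r \<le> quotient \<phi> v (z + s *\<^sub>R a, s)"
  shows "r \<le> P z v"
proof (rule ccontr)
  assume "\<not> r \<le> P z v"
  then have "eventually (\<lambda>a. quotient \<phi> v a < r) (base_filter z)"
    by (intro eventually_quotient_less) (simp add: p_eq_P[OF z v])
  then obtain e where e: "0 < e" "\<And>y t. y \<in> C \<Longrightarrow> \<mu> (y - z) < e \<Longrightarrow> 0 < t \<Longrightarrow> t < e \<Longrightarrow>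
      quotient \<phi> v (y, t) < r"
    unfolding eventually_base_filter[OF ball_in_C[OF z]] by blast
  have a0: "0 \<le> \<mu> a" by (rule minkowski_nonneg[OF a])
  obtain s where "0 < s" "s < min \<delta> (e / (\<mu> a + 1))"
    using dense[of 0 "min \<delta> (e / (\<mu> a + 1))"] \<open>0 < \<delta>\<close> e(1) a0 by auto
  then have s: "0 < s" "s < \<delta>" "s * \<mu> a + s < e" using a0 by (auto simp: field_simps)
  then have "s < e" "s * \<mu> a < e" using mult_nonneg_nonneg[of s "\<mu> a"] a0 by linarith+
  then have "\<mu> (z + s *\<^sub>R a - z) < e"
    using minkowski_scale_le[OF a, of s] s by simp
  then show False using e(2)[of "z + s *\<^sub>R a" s] ge[OF s(1,2)] s \<open>s < e\<close> by force
qed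

section \<open>Attained subgradient values and the mean-value theorem\<close>

lemma subdifferential_value:
  assumes z: "z \<in> ball" and d: "d \<in> X" and c: "c \<le> P z d" and c': "- c \<le> P z (- d)"
  obtains \<zeta> where "\<zeta> \<in> clarke_subdifferential C x0 \<phi> z" "\<zeta> d = c"
proof -
  \<comment> \<open>\<open>P z\<close> is sublinear only on \<open>X\<close>. Composing with a
    linear projection onto \<open>X\<close> extends it to the whole space, and restricting the
    functional found there to \<open>X\<close> yields an element of the algebraic dual.\<close>
  obtain \<pi> where \<pi>: "range \<pi> \<subseteq> X" "linear \<pi>" "\<And>v. v \<in> X \<Longrightarrow> \<pi> v = v"
    using linear_exists_left_inverse_on[OF linear_id subspace_X] by auto
  have \<pi>X: "\<pi> v \<in> X" for v using \<pi>(1) by auto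
  have "sublinear (P z \<circ> \<pi>)"
    unfolding sublinear_def
    by (auto simp: linear_add[OF \<pi>(2)] linear_scale[OF \<pi>(2)] P_add[OF z \<pi>X \<pi>X] P_scale[OF z \<pi>X])
  moreover have "c \<le> (P z \<circ> \<pi>) d" "- c \<le> (P z \<circ> \<pi>) (- d)"
    using c c' \<pi>(3) d subspace_neg[OF subspace_X d] by auto
  ultimately obtain q where q: "linear q" "q \<le> P z \<circ> \<pi>" "q d = c"
    by (rule hahn_banach_point)
  have "q v \<le> P z v" if "v \<in> X" for v
    using q(2) \<pi>(3)[OF that] by (auto simp: le_fun_def dest: spec[of _ v])
  then have "restrict q X \<in> clarke_subdifferential C x0 \<phi> z"
    by (auto simp: clarke_subdifferential_def algebraic_dual_def p_eq_P[OF z]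
        linear_add[OF q(1)] linear_scale[OF q(1)]
        subspace_add[OF subspace_X] subspace_scale[OF subspace_X])
  then show ?thesis using that[of "restrict q X"] q(3) d by simp
qed

lemma lebourg:
  assumes x: "x \<in> ball" and y: "y \<in> ball" and "x \<noteq> y"
  shows "\<exists>z \<in> open_segment x y.
           \<phi> y - \<phi> x \<in> {\<zeta> (y - x) | \<zeta>. \<zeta> \<in> clarke_subdifferential C x0 \<phi> z}"
proof -
  define d where "d = y - x"
  define c where "c = \<phi> y - \<phi> x"
  define g where "g t = \<phi> (x + t *\<^sub>R d) - t * c" for t
  have d: "d \<in> X" unfolding d_def by (intro C_diff_in_X ball_in_C x y)
  have in_ball: "x + t *\<^sub>R d \<in> ball" if "t \<in> {0..1}" for t
    using convexD_alt[OF convex_ball x y, of t] that by (simp add: d_def algebra_simps)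
  have "(L * \<mu> d)-lipschitz_on {0..1} (\<lambda>t. \<phi> (x + t *\<^sub>R d))"
  proof (rule lipschitz_onI)
    fix s t :: real assume st: "s \<in> {0..1}" "t \<in> {0..1}"
    have "\<bar>\<phi> (x + s *\<^sub>R d) - \<phi> (x + t *\<^sub>R d)\<bar> \<le> L * \<mu> ((x + s *\<^sub>R d) - (x + t *\<^sub>R d))"
      using lip ball_in_C[OF in_ball[OF st(1)]] ball_in_C[OF in_ball[OF st(2)]]
      unfolding minkowski_lipschitz_def by blast
    also have "(x + s *\<^sub>R d) - (x + t *\<^sub>R d) = (s - t) *\<^sub>R d" by (simp add: algebra_simps)
    also have "L * \<mu> ((s - t) *\<^sub>R d) \<le> L * (\<bar>s - t\<bar> * \<mu> d)"
      using minkowski_scale_le[OF d, of "s - t"] L_pos by simp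
    finally show "dist (\<phi> (x + s *\<^sub>R d)) (\<phi> (x + t *\<^sub>R d)) \<le> L * \<mu> d * dist s t"
      by (simp add: dist_real_def mult_ac)
  qed (use L_pos minkowski_nonneg[OF d] in simp)
  then have "continuous_on {0..1} g"
    unfolding g_def by (intro continuous_intros lipschitz_on_continuous_on)
  moreover have "g 0 = g 1" by (simp add: g_def c_def d_def)
  ultimately obtain t where t: "0 < t" "t < 1"
    and ext: "(\<forall>s\<in>{0..1}. g s \<le> g t) \<or> (\<forall>s\<in>{0..1}. g t \<le> g s)"
    using rolle_extremum[of 0 1 g] by auto
  define z where "z = x + t *\<^sub>R d"
  \<comment> \<open>Steps below \<open>\<delta>\<close> keep both \<open>t + s\<close> and
    \<open>t - s\<close> in the unit interval.\<close>
  define \<delta> where "\<delta> = min t (1 - t)"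
  have z: "z \<in> ball" unfolding z_def using t by (intro in_ball) simp
  have \<delta>: "0 < \<delta>" using t by (simp add: \<delta>_def)
  have shift: "z + s *\<^sub>R d = x + (t + s) *\<^sub>R d" for s by (simp add: z_def algebra_simps)
  have phi: "\<phi> (z + s *\<^sub>R d) = g (t + s) + (t + s) * c" for s by (simp add: shift g_def)
  have C: "z + s *\<^sub>R d \<in> C" if "\<bar>s\<bar> < \<delta>" for s
    unfolding shift using that by (intro ball_in_C in_ball) (auto simp: \<delta>_def)
  have \<phi>z: "\<phi> z = g t + t * c" using phi[of 0] by simp
  have dirs: "d \<in> X" "- d \<in> X" "0 \<in> X"
    using d subspace_neg[OF subspace_X d] subspace_0[OF subspace_X] by auto
  have "c \<le> P z d \<and> - c \<le> P z (- d)"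
    using ext
  proof
    assume max: "\<forall>s\<in>{0..1}. g s \<le> g t"
    have "c \<le> P z d"
    \<comment> \<open>The quotient from \<open>z - s *\<^sub>R d\<close> to \<open>z\<close> equals
      \<open>c + (g t - g (t - s)) / s\<close>, which is at least \<open>c\<close> at a maximum. The
      opposite direction starts from \<open>z + s *\<^sub>R d\<close>.\<close>
    proof (rule P_ge[OF z dirs(1) dirs(2) \<delta>])
      fix s assume s: "0 < s" "s < \<delta>"
      then have "g (t - s) \<le> g t" using max t by (auto simp: \<delta>_def)
      then show "z + s *\<^sub>R (- d) \<in> C \<and> c \<le> quotient \<phi> d (z + s *\<^sub>R (- d), s)"
        using C[of "- s"] s phi[of "- s"] \<phi>z by (simp add: field_simps)
    qed
    moreover have "- c \<le> P z (- d)"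
    proof (rule P_ge[OF z dirs(2) dirs(1) \<delta>])
      fix s assume s: "0 < s" "s < \<delta>"
      then have "g (t + s) \<le> g t" using max t by (auto simp: \<delta>_def)
      then show "z + s *\<^sub>R d \<in> C \<and> - c \<le> quotient \<phi> (- d) (z + s *\<^sub>R d, s)"
        using C[of s] s phi[of s] \<phi>z by (simp add: field_simps)
    qed
    ultimately show ?thesis ..
  next
    assume min: "\<forall>s\<in>{0..1}. g t \<le> g s"
    have "c \<le> P z d"
    \<comment> \<open>At a minimum the base point stays at \<open>z\<close>, hence the ray direction
      0: the quotient is \<open>c + (g (t + s) - g t) / s\<close>.\<close>
    proof (rule P_ge[OF z dirs(1) dirs(3) \<delta>])
      fix s assume s: "0 < s" "s < \<delta>"
      then have "g t \<le> g (t + s)" using min t by (auto simp: \<delta>_def)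
      then show "z + s *\<^sub>R 0 \<in> C \<and> c \<le> quotient \<phi> d (z + s *\<^sub>R 0, s)"
        using ball_in_C[OF z] s phi[of s] \<phi>z by (simp add: field_simps)
    qed
    moreover have "- c \<le> P z (- d)"
    proof (rule P_ge[OF z dirs(2) dirs(3) \<delta>])
      fix s assume s: "0 < s" "s < \<delta>"
      then have "g t \<le> g (t - s)" using min t by (auto simp: \<delta>_def)
      then show "z + s *\<^sub>R 0 \<in> C \<and> - c \<le> quotient \<phi> (- d) (z + s *\<^sub>R 0, s)"
        using ball_in_C[OF z] s phi[of "- s"] \<phi>z by (simp add: field_simps)
    qed
    ultimately show ?thesis ..
  qed
  then obtain \<zeta> where "\<zeta> \<in> clarke_subdifferential C x0 \<phi> z" "\<zeta> d = c"
    using subdifferential_value[OF z d] by blast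
  moreover have "z \<in> open_segment x y"
    unfolding in_segment using \<open>x \<noteq> y\<close> t
    by (auto simp: z_def d_def algebra_simps intro!: exI[of _ t])
  ultimately show ?thesis unfolding c_def d_def
    by (intro bexI[of _ z] CollectI exI[of _ \<zeta>]) auto
qed

end

theorem theorem3p1:
  fixes C :: "'a::real_vector set" and x0 x y :: 'a and \<phi> :: "'a \<Rightarrow> real" and L :: real
  assumes "convex C"
    and "x0 \<in> C"
    and "symmetric_wrt C x0"
    and "L > 0"
    and "minkowski_lipschitz L C x0 \<phi>"
    and "x \<in> minkowski_unit_ball C x0"
    and "y \<in> minkowski_unit_ball C x0"
    and "x \<noteq> y"
  shows "\<exists>z \<in> open_segment x y.
           \<phi> y - \<phi> x \<in> {\<zeta> (y - x) | \<zeta>. \<zeta> \<in> clarke_subdifferential C x0 \<phi> z}"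
proof -
  interpret lipschitz_on_symmetric C x0 \<phi> L
    using assms by unfold_locales
  show ?thesis using assms by (intro lebourg)
qed

end
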